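(* Setup: - Let $G_1=(V_1,E_1)$ and $G_2=(V_2,E_2)$ be graphs with $V_1\cap V_2=\{A\}$, and let $G=G_1+_AG_2$ be their union (glued at $A$). - Let $\mathcal G_1=\langle G_1,h_1,g_1\rangle$ and $\mathcal G_2=\langle G_2,h_2,g_2\rangle$ be losing games. - Suppose that for some positive integer $s$ we have $g_1(A)=g_2(A)=s$ and $h_1(A)\ge h_2(A)=s+1$. - Define $h(x)=h_i(x)$ and $g(x)=g_i(x)$ for $x\in V_i\setminus\{A\}$ ($i=1,2$), and $h(A)=h_1(A)$, $g(A)=s$. Conclusion: the game $\langle G,h,g\rangle$ is losing.
   Context: Hat guessing game $\langle G,h,g\rangle$: $G=(V,E)$ is a finite graph and $h,g\colon V\to\mathbb N$. The adversary gives each vertex $v$ a color in $\{0,\dots,h(v)-1\}$. Each vertex sees only its neighbors' colors and names at most $g(v)$ colors via a deterministic strategy fixed in advance that depends only on those colors. The game is winning if some strategy ensures that for every assignment some vertex names its own color; otherwise it is losing. *)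

theory Defs
  imports "HOL-Library.FuncSet" "Graph_Theory.Pair_Digraph"
begin

text \<open>
  Finite simple graphs are symmetric loop-free digraphs (\<^locale>\<open>pair_graph\<close>), so each edge
  is represented by its two orientations.
\<close>

definition neighbors :: "'a pair_pre_digraph \<Rightarrow> 'a \<Rightarrow> 'a set" where
  "neighbors G v = {u. (v, u) \<in> parcs G}"

definition colorings :: "'a set \<Rightarrow> ('a \<Rightarrow> nat) \<Rightarrow> ('a \<Rightarrow> nat) set" where
  "colorings V h = (\<Pi>\<^sub>E v\<in>V. {..<h v})"

text \<open>
  A strategy assigns to every vertex a function from the colorings of its neighborhood to sets of
  at most \<open>g v\<close> colors. The inclusion in \<open>{..<h v}\<close> also excludes infinite
  sets, whose cardinality is 0 by convention.
\<close>

definition strategy ::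
  "'a pair_pre_digraph \<Rightarrow> ('a \<Rightarrow> nat) \<Rightarrow> ('a \<Rightarrow> nat) \<Rightarrow> ('a \<Rightarrow> ('a \<Rightarrow> nat) \<Rightarrow> nat set) \<Rightarrow> bool" where
  "strategy G h g f \<longleftrightarrow>
     (\<forall>v\<in>pverts G. \<forall>x\<in>colorings (neighbors G v) h. f v x \<subseteq> {..<h v} \<and> card (f v x) \<le> g v)"

definition winning_game ::
  "'a pair_pre_digraph \<Rightarrow> ('a \<Rightarrow> nat) \<Rightarrow> ('a \<Rightarrow> nat) \<Rightarrow> bool" where
  "winning_game G h g \<longleftrightarrow>
     (\<exists>f. strategy G h g f \<and>
        (\<forall>c\<in>colorings (pverts G) h. \<exists>v\<in>pverts G. c v \<in> f v (restrict c (neighbors G v))))"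

definition losing_game ::
  "'a pair_pre_digraph \<Rightarrow> ('a \<Rightarrow> nat) \<Rightarrow> ('a \<Rightarrow> nat) \<Rightarrow> bool" where
  "losing_game G h g \<longleftrightarrow> \<not> winning_game G h g"

text \<open>The union of two graphs; vertices with the same name are identified.\<close>

definition graph_union ::
  "'a pair_pre_digraph \<Rightarrow> 'a pair_pre_digraph \<Rightarrow> 'a pair_pre_digraph" where
  "graph_union G1 G2 =
     \<lparr>pverts = pverts G1 \<union> pverts G2, parcs = parcs G1 \<union> parcs G2\<rparr>"

end

theory Submission
  imports Defs
begin

text \<open>
  Fix a strategy \<open>f\<close> on \<open>G\<close>. For any \<open>s + 1\<close> colors of \<open>A\<close>, some coloring \<open>y\<close> of the
  \<open>G2\<close>-neighborhood of \<open>A\<close> extends, whichever of these colors \<open>A\<close> receives, to a coloring of \<open>G2\<close>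
  on which no vertex other than \<open>A\<close> guesses right: otherwise \<open>A\<close>, seeing \<open>y\<close>, could discard one of
  the \<open>s + 1\<close> colors and name the other \<open>s\<close>, winning on \<open>G2\<close>. Now let \<open>A\<close>, seeing \<open>x\<close> on
  its \<open>G1\<close>-neighborhood, name all colors that \<open>f\<close> names for every such \<open>y\<close> compatible with that
  color. There are at most \<open>s\<close> of them, since \<open>s + 1\<close> of them would all be named by \<open>f\<close> on one
  common \<open>y\<close>. If \<open>f\<close> wins on \<open>G\<close>, this strategy wins on \<open>G1\<close>.
\<close>

text \<open>The guess of \<open>A\<close> is left out because in the glued graph it also depends on
  the other side. The equation for \<open>y\<close> forces it to be the restriction of a genuine
  coloring.\<close>

definition avoids ::
  "'a pair_pre_digraph \<Rightarrow> ('a \<Rightarrow> nat) \<Rightarrow> ('a \<Rightarrow> ('a \<Rightarrow> nat) \<Rightarrow> nat set) \<Rightarrow> 'a \<Rightarrow> ('a \<Rightarrow> nat) \<Rightarrow> nat \<Rightarrow> bool"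
  where
  "avoids G h f A y a \<longleftrightarrow>
     (\<exists>c\<in>colorings (pverts G) h. c A = a \<and> restrict c (neighbors G A) = y \<and>
        (\<forall>v\<in>pverts G - {A}. c v \<notin> f v (restrict c (neighbors G v))))"

lemma restrict_colorings:
  assumes "c \<in> colorings V h" "W \<subseteq> V"
  shows "restrict c W \<in> colorings W h"
  using assms by (auto simp: colorings_def PiE_iff)

lemma colorings_cong:
  assumes "\<And>v. v \<in> V \<Longrightarrow> h v = h' v"
  shows "colorings V h = colorings V h'"
  unfolding colorings_def using assms by (auto intro!: PiE_cong)

lemma neighbors_subset:
  assumes "pair_graph G"
  shows "neighbors G v \<subseteq> pverts G - {v}"
proof -
  interpret pair_graph G by fact
  show ?thesis
    using no_loops in_arcsD2 by (fastforce simp: neighbors_def)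
qed

lemma neighbors_outside:
  assumes "pair_graph G" "v \<notin> pverts G"
  shows "neighbors G v = {}"
proof -
  interpret pair_graph G by fact
  show ?thesis
    using assms(2) in_arcsD1 by (fastforce simp: neighbors_def)
qed

lemma neighbors_graph_union:
  "neighbors (graph_union G1 G2) v = neighbors G1 v \<union> neighbors G2 v"
  by (auto simp: neighbors_def graph_union_def)

text \<open>The lost game gives \<open>A\<close> only \<open>s + 1\<close> colors, while
  \<open>h A\<close> may be larger. Renaming \<open>{..<s + 1}\<close> to \<open>S\<close> transfers
  the loss to any \<open>s + 1\<close> colors of \<open>A\<close>.\<close>

lemma common_avoided:
  assumes G: "pair_graph G" and A: "A \<in> pverts G"
    and losing: "losing_game G h' g'" and "g' A = s" "h' A = s + 1"
    and h: "\<And>v. v \<in> pverts G - {A} \<Longrightarrow> h v = h' v"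
    and f: "\<And>v x. v \<in> pverts G - {A} \<Longrightarrow> x \<in> colorings (neighbors G v) h \<Longrightarrow>
              f v x \<subseteq> {..<h v} \<and> card (f v x) \<le> g' v"
    and S: "S \<subseteq> {..<h A}" "card S = s + 1"
  shows "\<exists>y. \<forall>a\<in>S. avoids G h f A y a"
proof (rule ccontr)
  assume no: "\<nexists>y. \<forall>a\<in>S. avoids G h f A y a"
  have "finite S" using S(2) by (simp add: card_ge_0_finite)
  then obtain b where "bij_betw b {0..<s + 1} S"
    using ex_bij_betw_nat_finite S(2) by metis
  then have b: "b ` {..<s + 1} = S" by (simp add: bij_betw_def atLeast0LessThan)
  have "\<exists>k<s + 1. \<not> avoids G h f A y (b k)" for y
    using no b by fastforce
  \<comment> \<open>\<open>r y\<close> indexes the color of \<open>S\<close> that \<open>A\<close>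
    can safely discard on seeing \<open>y\<close>.\<close>
  then obtain r where r: "\<And>y. r y < s + 1" "\<And>y. \<not> avoids G h f A y (b (r y))"
    by metis
  have bS: "b k < h A" if "k < s + 1" for k using b S(1) that by blast
  note nb = neighbors_subset[OF G]
  \<comment> \<open>The other vertices rename the color of \<open>A\<close> by \<open>b\<close>
    before consulting \<open>f\<close>. The outer \<open>restrict\<close> drops this update for
    vertices not adjacent to \<open>A\<close>.\<close>
  define f' where "f' v x = (if v = A then {..<s + 1} - {r x}
      else f v (restrict (x(A := b (x A))) (neighbors G v)))" for v x
  have recolor: "restrict (x(A := b (x A))) W \<in> colorings W h"
    if x: "x \<in> colorings W h'" and W: "W \<subseteq> pverts G" for x W
    using x W h bS \<open>h' A = s + 1\<close> by (fastforce simp: colorings_def PiE_iff)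
  have "strategy G h' g' f'"
    unfolding strategy_def
  proof (intro ballI)
    fix v x assume v: "v \<in> pverts G" and x: "x \<in> colorings (neighbors G v) h'"
    show "f' v x \<subseteq> {..<h' v} \<and> card (f' v x) \<le> g' v"
    proof (cases "v = A")
      case True
      then show ?thesis using r(1)[of x] assms(4,5) by (auto simp: f'_def)
    next
      case False
      then have "restrict (x(A := b (x A))) (neighbors G v) \<in> colorings (neighbors G v) h"
        using recolor x nb by blast
      then show ?thesis using f[of v] h[of v] v False by (auto simp: f'_def)
    qed
  qed
  with losing obtain c where c: "c \<in> colorings (pverts G) h'"
    and cf: "\<And>v. v \<in> pverts G \<Longrightarrow> c v \<notin> f' v (restrict c (neighbors G v))"
    unfolding losing_game_def winning_game_def by blast
  have "c A < s + 1" using c A assms(5) by (auto simp: colorings_def PiE_iff)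
  \<comment> \<open>The wrong guess of \<open>A\<close> pins its color down, since \<open>f'\<close>
    omits just one of the \<open>s + 1\<close> colors.\<close>
  then have cA: "c A = r (restrict c (neighbors G A))"
    using cf[OF A] by (simp add: f'_def)
  define c' where "c' = restrict (c(A := b (c A))) (pverts G)"
  have "c' \<in> colorings (pverts G) h" using recolor[OF c] by (simp add: c'_def)
  moreover have "c' A = b (c A)" using A by (simp add: c'_def)
  moreover have "restrict c' (neighbors G A) = restrict c (neighbors G A)"
    using nb by (fastforce simp: c'_def restrict_def fun_eq_iff)
  moreover have "c' v \<notin> f v (restrict c' (neighbors G v))" if v: "v \<in> pverts G - {A}" for v
  proof -
    have "restrict c' (neighbors G v) =
      restrict ((restrict c (neighbors G v))(A := b (restrict c (neighbors G v) A))) (neighbors G v)"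
      using nb[of v] by (auto simp: c'_def restrict_def fun_eq_iff)
    then show ?thesis using cf[of v] v by (auto simp: f'_def c'_def)
  qed
  ultimately have "avoids G h f A (restrict c (neighbors G A)) (b (c A))"
    unfolding avoids_def by blast
  then show False using r(2) cA by metis
qed

theorem theorem2p10:
  fixes G1 G2 G :: "'a pair_pre_digraph"
    and h1 g1 h2 g2 h g :: "'a \<Rightarrow> nat"
    and A :: 'a and s :: nat
  assumes "pair_graph G1" and "pair_graph G2"
    and "pverts G1 \<inter> pverts G2 = {A}"
    and "G = graph_union G1 G2"
    and "losing_game G1 h1 g1" and "losing_game G2 h2 g2"
    and "s > 0"
    and "g1 A = s" and "g2 A = s"
    and "h1 A \<ge> h2 A" and "h2 A = s + 1"
    and "\<And>x. x \<in> pverts G1 - {A} \<Longrightarrow> h x = h1 x \<and> g x = g1 x"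
    and "\<And>x. x \<in> pverts G2 - {A} \<Longrightarrow> h x = h2 x \<and> g x = g2 x"
    and "h A = h1 A" and "g A = s"
  shows "losing_game G h g"
proof -
  have A: "A \<in> pverts G1" "A \<in> pverts G2" using assms(3) by auto
  have V: "pverts G = pverts G1 \<union> pverts G2" by (simp add: assms(4) graph_union_def)
  have N: "neighbors G v = neighbors G1 v \<union> neighbors G2 v" for v
    by (simp add: assms(4) neighbors_graph_union)
  note nb1 = neighbors_subset[OF assms(1)] and nb2 = neighbors_subset[OF assms(2)]
  have N1: "neighbors G v = neighbors G1 v" if "v \<in> pverts G1 - {A}" for v
    using that N neighbors_outside[OF assms(2), of v] assms(3) by auto
  have N2: "neighbors G v = neighbors G2 v" if "v \<in> pverts G2 - {A}" for v
    using that N neighbors_outside[OF assms(1), of v] assms(3) by auto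
  have h1: "h v = h1 v" if "v \<in> pverts G1" for v using that assms(12,14) by blast
  have col1: "colorings W h1 = colorings W h" if "W \<subseteq> pverts G1" for W
    by (rule colorings_cong) (use h1 that in fastforce)
  have False if "winning_game G h g"
  proof -
    from that obtain f where f: "strategy G h g f"
      and win: "\<And>c. c \<in> colorings (pverts G) h \<Longrightarrow>
                  \<exists>v\<in>pverts G. c v \<in> f v (restrict c (neighbors G v))"
      unfolding winning_game_def by blast
    have fD: "f v x \<subseteq> {..<h v} \<and> card (f v x) \<le> g v"
      if "v \<in> pverts G" "x \<in> colorings (neighbors G v) h" for v x
      using f that by (auto simp: strategy_def)
    \<comment> \<open>Off both neighborhoods of \<open>A\<close> the value is that of
      \<open>y\<close>, hence \<open>undefined\<close> once \<open>y\<close> is extensional.\<close>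
    define glue where "glue x y = (\<lambda>v. if v \<in> neighbors G1 A then x v else y v)"
      for x y :: "'a \<Rightarrow> nat"
    \<comment> \<open>A color admitting no \<open>y\<close> is included vacuously, so every color
      below \<open>h A\<close> outside \<open>F x\<close> comes with a witness
      \<open>y\<close>.\<close>
    define F where "F x = {a. a < h A \<and> (\<forall>y. avoids G2 h f A y a \<longrightarrow> a \<in> f A (glue x y))}" for x
    have card_F: "card (F x) \<le> s" if x: "x \<in> colorings (neighbors G1 A) h" for x
    proof (rule ccontr)
      assume "\<not> card (F x) \<le> s"
      then obtain S where S: "S \<subseteq> F x" "card S = s + 1"
        using obtain_subset_with_card_n[of "s + 1" "F x"] by auto
      have "\<exists>y. \<forall>a\<in>S. avoids G2 h f A y a"
      proof (rule common_avoided[OF assms(2) A(2) assms(6,9,11)])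
        show "f v x \<subseteq> {..<h v} \<and> card (f v x) \<le> g2 v"
          if "v \<in> pverts G2 - {A}" "x \<in> colorings (neighbors G2 v) h" for v x
          using fD[of v x] that V N2[of v] assms(13)[of v] by auto
      qed (use assms(13) S in \<open>auto simp: F_def\<close>)
      then obtain y where y: "\<And>a. a \<in> S \<Longrightarrow> avoids G2 h f A y a" by blast
      \<comment> \<open>One member of \<open>S\<close> is needed to see that \<open>y\<close> is a
        coloring; only then is \<open>glue x y\<close> an input on which \<open>f A\<close> names at
        most \<open>s\<close> colors.\<close>
      have "S \<noteq> {}" using S(2) by auto
      then have "y \<in> colorings (neighbors G2 A) h"
        using y nb2[of A] by (fastforce simp: avoids_def intro: restrict_colorings)
      then have "glue x y \<in> colorings (neighbors G A) h"
        using x unfolding N by (auto simp: glue_def colorings_def PiE_iff extensional_def)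
      then have fA: "f A (glue x y) \<subseteq> {..<h A}" "card (f A (glue x y)) \<le> s"
        using fD[of A] A V assms(15) by auto
      have "S \<subseteq> f A (glue x y)" using S(1) y by (auto simp: F_def)
      then have "card S \<le> card (f A (glue x y))"
        using fA(1) by (meson card_mono finite_lessThan finite_subset)
      then show False using S(2) fA(2) by simp
    qed
    have "strategy G1 h1 g1 (f(A := F))"
      unfolding strategy_def
    proof (intro ballI)
      fix v x assume v: "v \<in> pverts G1" and "x \<in> colorings (neighbors G1 v) h1"
      then have x: "x \<in> colorings (neighbors G1 v) h" using col1 nb1[of v] by blast
      show "(f(A := F)) v x \<subseteq> {..<h1 v} \<and> card ((f(A := F)) v x) \<le> g1 v"
      proof (cases "v = A")
        case True
        then show ?thesis using card_F x assms(8,14) by (auto simp: F_def)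
      next
        case False
        then show ?thesis using fD[of v x] v x V N1[of v] assms(12)[of v] by auto
      qed
    qed
    with assms(5) obtain c1 where "c1 \<in> colorings (pverts G1) h1"
      and c1f: "\<And>v. v \<in> pverts G1 \<Longrightarrow> c1 v \<notin> (f(A := F)) v (restrict c1 (neighbors G1 v))"
      unfolding losing_game_def winning_game_def by blast
    then have c1: "c1 \<in> colorings (pverts G1) h" using col1 by blast
    define x where "x = restrict c1 (neighbors G1 A)"
    have "c1 A < h A" using c1 A by (auto simp: colorings_def PiE_iff)
    \<comment> \<open>The wrong guess of \<open>F\<close> supplies the view \<open>y\<close> on
      which \<open>f\<close> misses the color of \<open>A\<close> as well.\<close>
    then obtain y where y: "avoids G2 h f A y (c1 A)" "c1 A \<notin> f A (glue x y)"
      using c1f[OF A(1)] by (auto simp: F_def x_def)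
    from y(1) obtain c2 where c2: "c2 \<in> colorings (pverts G2) h" "c2 A = c1 A"
      "restrict c2 (neighbors G2 A) = y"
      and c2f: "\<And>v. v \<in> pverts G2 - {A} \<Longrightarrow> c2 v \<notin> f v (restrict c2 (neighbors G2 v))"
      unfolding avoids_def by blast
    \<comment> \<open>The two colorings agree at the only shared vertex \<open>A\<close>, so each
      vertex other than \<open>A\<close> sees what it saw on its own side.\<close>
    define c where "c v = (if v \<in> pverts G1 then c1 v else c2 v)" for v
    have cc1: "c v = c1 v" if "v \<in> pverts G1" for v using that by (simp add: c_def)
    have cc2: "c v = c2 v" if "v \<in> pverts G2" for v
      using that assms(3) c2(2) by (cases "v = A") (auto simp: c_def)
    have "c \<in> colorings (pverts G) h"
      using c1 c2(1) V by (auto simp: c_def colorings_def PiE_iff extensional_def)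
    then obtain v where v: "v \<in> pverts G" "c v \<in> f v (restrict c (neighbors G v))"
      using win by blast
    have r1: "restrict c (neighbors G1 v) = restrict c1 (neighbors G1 v)" for v
      using nb1[of v] cc1 by (auto intro!: restrict_ext)
    have r2: "restrict c (neighbors G2 v) = restrict c2 (neighbors G2 v)" for v
      using nb2[of v] cc2 by (auto intro!: restrict_ext)
    consider "v = A" | "v \<in> pverts G1 - {A}" | "v \<in> pverts G2 - {A}" using v V by blast
    then show False
    proof cases
      case 1
      have "restrict c (neighbors G A) = glue x y"
        unfolding N glue_def x_def c2(3)[symmetric] r1[symmetric] r2[symmetric]
        by (auto simp: fun_eq_iff)
      then show False using v(2) y(2) 1 cc1[OF A(1)] by simp
    next
      case 2
      then show False using v(2) c1f[of v] cc1[of v] r1[of v] N1[of v] by auto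
    next
      case 3
      then show False using v(2) c2f[of v] cc2[of v] r2[of v] N2[of v] by auto
    qed
  qed
  then show ?thesis by (auto simp: losing_game_def)
qed

end
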